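(* Let $X$ be a positive integer and let $$b=\frac{-1+\sqrt{4X+1}}{2}.$$ Let $S(X)=\left\{m : m=\left\lfloor \frac{X}{n}\right\rfloor \text{ for some positive integer } n\le X\right\}$. Then $$|S(X)|=\lfloor b\rfloor+\left\lfloor\frac{X}{\lfloor b+1\rfloor}\right\rfloor.$$
   Context: The variables $m$ and $n$ range over positive integers. For a real number $y$, $\lfloor y\rfloor$ denotes the greatest integer not exceeding $y$. $|S(X)|$ denotes the cardinality of the set $S(X)$ (distinct values are counted once). *)

theory Defs
  imports Complex_Main
begin

definition S :: "nat \<Rightarrow> int set" where
  "S X = {m. m > 0 \<and> (\<exists>n::nat. 1 \<le> n \<and> n \<le> X \<and> m = \<lfloor>real X / real n\<rfloor>)}"

end

theory Submission
  imports Defs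
begin

text \<open>
  Write \<open>k = \<lfloor>b\<rfloor>\<close>; since \<open>b (b + 1) = X\<close>, this is the largest \<open>k\<close> with \<open>k (k + 1) \<le> X\<close>. For
  \<open>n \<le> k\<close> consecutive quotients satisfy \<open>X / n - X / (n + 1) \<ge> 1\<close>, so \<open>n \<le> k + 1\<close> yields pairwise
  distinct floors. From \<open>n = k + 1\<close> on no value is skipped: if \<open>m (k + 1) \<le> X\<close> then \<open>m \<le> k + 1\<close>, and
  \<open>n = \<lfloor>X / m\<rfloor> \<ge> m\<close> exceeds the remainder of \<open>X\<close> modulo \<open>m\<close>, so that \<open>\<lfloor>X / n\<rfloor> = m\<close>.
\<close>

text \<open>For \<open>q = X div Suc i\<close> the last assumption gives i \<le> q, hence (q + 1) i
  \<le> q (i + 1) \<le> X, so \<open>X div i\<close> is at least q + 1.\<close>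

lemma div_less_div_if_mult_Suc_le:
  fixes X i j :: nat
  assumes "0 < i" "i < j" "i * Suc i \<le> X"
  shows "X div j < X div i"
proof -
  have "X div j \<le> X div Suc i"
    using assms(2) by (intro div_le_mono2) auto
  also have "\<dots> < X div i"
  proof -
    define q where "q = X div Suc i"
    have q: "q * Suc i \<le> X"
      unfolding q_def by (rule div_times_less_eq_dividend)
    have "i \<le> q"
      using assms(3) unfolding q_def by (simp add: less_eq_div_iff_mult_less_eq del: mult_Suc_right)
    with q have "Suc q * i \<le> X" by simp
    then show ?thesis
      unfolding q_def[symmetric] using assms(1)
        by (simp add: less_eq_div_iff_mult_less_eq Suc_le_eq[symmetric] del: mult_Suc)
  qed
  finally show ?thesis .
qed

lemma div_div_eq_self:
  fixes X m :: nat
  assumes "0 < m" "m \<le> X div m"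
  shows "X div (X div m) = m"
proof (rule div_nat_eqI)
  show "X div m * m \<le> X"
    by (rule div_times_less_eq_dividend)
  have "X = X div m * m + X mod m" by simp
  also have "\<dots> < X div m * Suc m"
    unfolding mult_Suc_right using mod_less_divisor[OF assms(1), of X] assms(2) by linarith
  finally show "X < X div m * Suc m" .
qed

lemma S_eq_image_div:
  "S X = int ` {m. 0 < m \<and> (\<exists>n. 1 \<le> n \<and> n \<le> X \<and> m = X div n)}"
  by (auto simp: S_def floor_divide_of_nat_eq image_iff)

text \<open>The quotients split at n = k + 1: those with n \<le> k form \<open>?A\<close>, and those
  from n = k + 1 on fill the whole interval \<open>?B\<close>.\<close>

lemma card_S:
  assumes "k * (k + 1) \<le> X" "X < (k + 1) * (k + 2)"
  shows "card (S X) = k + X div (k + 1)"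
proof -
  let ?A = "(\<lambda>n. X div n) ` {1..k}" and ?B = "{1..X div (k + 1)}"
  have decr: "X div j < X div i" if "1 \<le> i" "i < j" "i \<le> k" for i j
  proof (rule div_less_div_if_mult_Suc_le)
    have "i * Suc i \<le> k * (k + 1)"
      using that(3) by (intro mult_le_mono) auto
    then show "i * Suc i \<le> X" using assms(1) by (rule le_trans)
  qed (use that in auto)
  have "inj_on (\<lambda>n. X div n) {1..k}"
    by (rule linorder_inj_onI) (use decr in fastforce)+
  then have card_A: "card ?A = k" by (simp add: card_image)
  \<comment> \<open>Since \<open>decr\<close> leaves j unbounded, j = k + 1 is allowed: all of
    \<open>?A\<close> lies above the maximum of \<open>?B\<close>.\<close>
  have disj: "?A \<inter> ?B = {}"
    using decr[of _ "k + 1"] by fastforce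
  have "{m. 0 < m \<and> (\<exists>n. 1 \<le> n \<and> n \<le> X \<and> m = X div n)} = ?A \<union> ?B" (is "?M = _")
  proof (intro equalityI subsetI)
    fix m assume "m \<in> ?M"
    then obtain n where n: "0 < m" "1 \<le> n" "m = X div n" by auto
    then show "m \<in> ?A \<union> ?B"
      using div_le_mono2[of "k + 1" n X] by (cases "n \<le> k") auto
  next
    fix m assume "m \<in> ?A \<union> ?B"
    then show "m \<in> ?M"
    proof
      assume "m \<in> ?A"
      then obtain n where n: "m = X div n" "1 \<le> n" "n \<le> k" by auto
      have "0 < m" using decr[of n "k + 1"] n by simp
      moreover from this n have "n \<le> X" by (auto simp: div_greater_zero_iff)
      ultimately show ?thesis using n by auto
    next
      assume "m \<in> ?B"
      then have m: "1 \<le> m" "m * (k + 1) \<le> X"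
        by (auto simp: less_eq_div_iff_mult_less_eq)
      \<comment> \<open>Cancelling k + 1 yields m \<le> k + 1 \<le> \<open>X div m\<close>, so
        \<open>X div m\<close> serves as the witness n.\<close>
      have "m * (k + 1) < (k + 2) * (k + 1)"
        using m(2) assms(2) by (simp only: mult.commute[of "k + 2"])
      then have "m \<le> k + 1" by (subst (asm) mult_less_cancel2) auto
      also have "k + 1 \<le> X div m"
        using m by (simp add: less_eq_div_iff_mult_less_eq mult.commute)
      finally have "X div (X div m) = m" "1 \<le> X div m"
        using m(1) by (auto intro: div_div_eq_self)
      then show ?thesis using m(1) div_le_dividend[of X m] by force
    qed
  qed
  then have "card (S X) = card (?A \<union> ?B)"
    by (simp add: S_eq_image_div card_image)
  also have "\<dots> = k + X div (k + 1)"
    using card_A disj by (subst card_Un_disjoint) auto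
  finally show ?thesis .
qed

theorem theorem1p1:
  fixes X :: nat and b :: real
  assumes "X > 0"
    and "b = (- 1 + sqrt (4 * real X + 1)) / 2"
  shows "int (card (S X)) = \<lfloor>b\<rfloor> + \<lfloor>real X / real_of_int \<lfloor>b + 1\<rfloor>\<rfloor>"
proof -
  have "0 \<le> b"
    unfolding assms(2) by (intro divide_nonneg_nonneg) (simp_all add: le_diff_eq)
  have "2 * b + 1 = sqrt (4 * real X + 1)"
    unfolding assms(2) by (simp add: field_simps)
  then have "(2 * b + 1)\<^sup>2 = 4 * real X + 1" by simp
  then have b: "b * (b + 1) = real X" by (simp add: power2_eq_square algebra_simps)
  define k where "k = nat \<lfloor>b\<rfloor>"
  have k: "\<lfloor>b\<rfloor> = int k" using \<open>0 \<le> b\<close> by (simp add: k_def)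
  then have "real k \<le> b" "b < real k + 1" by linarith+
  \<comment> \<open>The map t (t + 1) is strictly increasing for t \<ge> 0 and takes the value X at
    b; it is compared at k \<le> b < k + 1.\<close>
  then have "real k * (real k + 1) \<le> real X" "real X < (real k + 1) * (real k + 2)"
    unfolding b[symmetric] using \<open>0 \<le> b\<close> by (auto intro!: mult_mono mult_strict_mono)
  then have "real (k * (k + 1)) \<le> real X" "real X < real ((k + 1) * (k + 2))"
    by (simp_all add: algebra_simps)
  then have "card (S X) = k + X div (k + 1)"
    by (intro card_S) (simp_all only: of_nat_le_iff of_nat_less_iff)
  moreover have "\<lfloor>real X / real_of_int \<lfloor>b + 1\<rfloor>\<rfloor> = int (X div (k + 1))"
    using floor_divide_of_nat_eq[of X "k + 1"] by (simp add: k add.commute)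
  ultimately show ?thesis by (simp add: k)
qed

end
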